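(* Let $n\ge 1$, let $\mathcal{L} \subset \mathbb{R}^{2n}$ be a Lagrangian subspace and $\mathbf{B} = (x_1, \ldots , x_n)$ any ordered basis of $\mathcal{L}$. Let $X_L = [\,x_1 \; \cdots \; x_{n-1}\,]$, $X_R = [\,x_2 \; \cdots \; x_n\,]$ in $\mathbb{R}^{2n\times(n-1)}$ and let $\widehat{H} := X_RX_L^+ + J_{2n}^T(X_RX_L^+)^TJ_{2n}\in \mathbb{R}^{2n \times 2n}$. Then $$ \Vert \widehat{H} \Vert_F \leq \Vert H \Vert_F \qquad \text{for all } H \in \mathbb{HK}(\mathbf{B}).$$
   Context: $J_{2n} = \begin{bmatrix} 0 & I_n \\ -I_n & 0 \end{bmatrix} \in \mathbb{R}^{2n\times 2n}$. A subspace $\mathcal{L}\subset\mathbb{R}^{2n}$ is called isotropic if $x^TJ_{2n}y = 0$ for all $x,y\in\mathcal{L}$, and Lagrangian if it is isotropic and of dimension $n$. A matrix $H\in\mathbb{R}^{2n\times 2n}$ is called skew-Hamiltonian if $J_{2n}^TH^TJ_{2n} = H$. For an ordered basis $\mathbf{B}=(x_1,\ldots,x_n)$ of a Lagrangian subspace, $\mathbb{HK}(\mathbf{B})$ denotes the set of all skew-Hamiltonian matrices $H\in\mathbb{R}^{2n\times 2n}$ satisfying $Hx_k = x_{k+1}$ for all $k=1,\ldots,n-1$. $A^+$ denotes the Moore-Penrose pseudoinverse of $A$ and $\Vert\cdot\Vert_F$ the Frobenius norm. (For $n=1$ the matrices $X_L,X_R$ have no columns and $X_RX_L^+$ is the zero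 matrix.) *)

theory Defs
  imports Complex_Main "Jordan_Normal_Form.VS_Connect"
begin

definition J_mat :: "nat \<Rightarrow> real mat" where
  "J_mat n = four_block_mat (0\<^sub>m n n) (1\<^sub>m n) (- 1\<^sub>m n) (0\<^sub>m n n)"

abbreviation real_space :: "nat \<Rightarrow> (real, real vec) module" where
  "real_space m \<equiv> module_vec TYPE(real) m"

abbreviation subspace_of :: "nat \<Rightarrow> real vec set \<Rightarrow> bool" where
  "subspace_of m L \<equiv> VectorSpace.subspace class_ring L (real_space m)"

definition isotropic :: "nat \<Rightarrow> real vec set \<Rightarrow> bool" where
  "isotropic n L \<longleftrightarrow> subspace_of (2 * n) L \<and> (\<forall>x\<in>L. \<forall>y\<in>L. x \<bullet> (J_mat n *\<^sub>v y) = 0)"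

definition lagrangian :: "nat \<Rightarrow> real vec set \<Rightarrow> bool" where
  "lagrangian n L \<longleftrightarrow>
     isotropic n L \<and> vectorspace.dim class_ring ((real_space (2 * n))\<lparr>carrier := L\<rparr>) = n"

definition ordered_basis :: "nat \<Rightarrow> real vec set \<Rightarrow> real vec list \<Rightarrow> bool" where
  "ordered_basis m L xs \<longleftrightarrow>
     distinct xs \<and> vectorspace.basis class_ring ((real_space m)\<lparr>carrier := L\<rparr>) (set xs)"

definition skew_hamiltonian :: "nat \<Rightarrow> real mat \<Rightarrow> bool" where
  "skew_hamiltonian n H \<longleftrightarrow>
     H \<in> carrier_mat (2 * n) (2 * n) \<and> (J_mat n)\<^sup>T * H\<^sup>T * J_mat n = H"

text \<open>Lists are indexed from 0, so the condition below is \<open>H x\<^sub>k = x\<^sub>k\<^sub>+\<^sub>1\<close> for \<open>k = 1, \<dots>, n - 1\<close>.\<close>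

definition HK :: "nat \<Rightarrow> real vec list \<Rightarrow> real mat set" where
  "HK n xs = {H. skew_hamiltonian n H \<and> (\<forall>k. Suc k < length xs \<longrightarrow> H *\<^sub>v (xs ! k) = xs ! Suc k)}"

definition frobenius_norm :: "real mat \<Rightarrow> real" where
  "frobenius_norm A = sqrt (\<Sum>i<dim_row A. \<Sum>j<dim_col A. (A $$ (i, j))\<^sup>2)"

text \<open>The four Penrose conditions.\<close>

definition is_pseudoinverse :: "real mat \<Rightarrow> real mat \<Rightarrow> bool" where
  "is_pseudoinverse A P \<longleftrightarrow>
     P \<in> carrier_mat (dim_col A) (dim_row A) \<and>
     A * P * A = A \<and> P * A * P = P \<and> (A * P)\<^sup>T = A * P \<and> (P * A)\<^sup>T = P * A"

text \<open>A real matrix has exactly one pseudoinverse. Uniqueness, and existence for matrices with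
  invertible Gram matrix (full column rank, including the case of no columns), are proved below.\<close>

definition pseudoinverse :: "real mat \<Rightarrow> real mat" where
  "pseudoinverse A = (THE P. is_pseudoinverse A P)"

lemma is_pseudoinverse_unique:
  assumes P: "is_pseudoinverse A P" and Q: "is_pseudoinverse A Q"
  shows "P = Q"
proof -
  define m n where "m = dim_row A" and "n = dim_col A"
  have A: "A \<in> carrier_mat m n" by (auto simp: m_def n_def)
  have cP: "P \<in> carrier_mat n m" and cQ: "Q \<in> carrier_mat n m"
    using P Q by (auto simp: is_pseudoinverse_def m_def n_def)
  note p = P[unfolded is_pseudoinverse_def] and q = Q[unfolded is_pseudoinverse_def]
  have AP: "A * P \<in> carrier_mat m m" and AQ: "A * Q \<in> carrier_mat m m"
    and PA: "P * A \<in> carrier_mat n n" and QA: "Q * A \<in> carrier_mat n n"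
    by (fact mult_carrier_mat[OF A cP] mult_carrier_mat[OF A cQ]
      mult_carrier_mat[OF cP A] mult_carrier_mat[OF cQ A])+
  have "A * P = (A * Q * A) * P" using q by simp
  also have "\<dots> = (A * Q) * (A * P)" by (rule assoc_mult_mat[OF AQ A cP])
  also have "\<dots> = (A * Q)\<^sup>T * (A * P)\<^sup>T" using p q by simp
  also have "\<dots> = ((A * P) * (A * Q))\<^sup>T" by (rule transpose_mult[OF AP AQ, symmetric])
  also have "(A * P) * (A * Q) = (A * P * A) * Q" by (rule assoc_mult_mat[OF AP A cQ, symmetric])
  also have "\<dots>\<^sup>T = A * Q" using p q by simp
  finally have 1: "A * P = A * Q" .
  have "P * A = P * (A * Q * A)" using q by simp
  also have "A * Q * A = A * (Q * A)" by (rule assoc_mult_mat[OF A cQ A])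
  also have "P * \<dots> = (P * A) * (Q * A)" by (rule assoc_mult_mat[OF cP A QA, symmetric])
  also have "\<dots> = (P * A)\<^sup>T * (Q * A)\<^sup>T" using p q by simp
  also have "\<dots> = ((Q * A) * (P * A))\<^sup>T" by (rule transpose_mult[OF QA PA, symmetric])
  also have "(Q * A) * (P * A) = Q * (A * (P * A))" by (rule assoc_mult_mat[OF cQ A PA])
  also have "A * (P * A) = A * P * A" by (rule assoc_mult_mat[OF A cP A, symmetric])
  also have "(Q * \<dots>)\<^sup>T = Q * A" using p q by simp
  finally have 2: "P * A = Q * A" .
  have "P = Q * A * P" using p 2 by simp
  also have "\<dots> = Q * (A * P)" by (rule assoc_mult_mat[OF cQ A cP])
  also have "\<dots> = Q * A * Q" unfolding 1 by (rule assoc_mult_mat[OF cQ A cQ, symmetric])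
  finally show ?thesis using q by simp
qed

lemma pseudoinverse_eqI: "is_pseudoinverse A P \<Longrightarrow> pseudoinverse A = P"
  unfolding pseudoinverse_def by (blast intro: is_pseudoinverse_unique)

lemma pseudoinverse_full_column_rank:
  assumes A: "A \<in> carrier_mat m n" and G: "G \<in> carrier_mat n n"
    and inv: "G * (A\<^sup>T * A) = 1\<^sub>m n" "(A\<^sup>T * A) * G = 1\<^sub>m n"
  shows "pseudoinverse A = G * A\<^sup>T"
proof (rule pseudoinverse_eqI)
  have At: "A\<^sup>T \<in> carrier_mat n m" using A by simp
  have S: "A\<^sup>T * A \<in> carrier_mat n n" using A by simp
  have GA: "G * A\<^sup>T \<in> carrier_mat n m" using G At by simp
  have St: "(A\<^sup>T * A)\<^sup>T = A\<^sup>T * A" by (subst transpose_mult[OF At A]) simp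
  have Gt: "G\<^sup>T = G"
  proof -
    have Gt: "G\<^sup>T \<in> carrier_mat n n" using G by simp
    have "(A\<^sup>T * A) * G\<^sup>T = (G * (A\<^sup>T * A))\<^sup>T" using transpose_mult[OF G S] St by simp
    then have l: "(A\<^sup>T * A) * G\<^sup>T = 1\<^sub>m n" using inv by simp
    have "G\<^sup>T = (G * (A\<^sup>T * A)) * G\<^sup>T" using inv Gt by simp
    also have "\<dots> = G * ((A\<^sup>T * A) * G\<^sup>T)" by (rule assoc_mult_mat[OF G S Gt])
    finally show ?thesis using l G by simp
  qed
  have PA: "(G * A\<^sup>T) * A = 1\<^sub>m n" using assoc_mult_mat[OF G At A] inv by simp
  have AP: "(A * (G * A\<^sup>T))\<^sup>T = A * (G * A\<^sup>T)"
    using transpose_mult[OF A GA] transpose_mult[OF G At] Gt assoc_mult_mat[OF A G At] by simp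
  show "is_pseudoinverse A (G * A\<^sup>T)"
    unfolding is_pseudoinverse_def
    using A GA AP PA assoc_mult_mat[OF A GA A] left_mult_one_mat[OF GA] by simp
qed

definition X_L :: "nat \<Rightarrow> real vec list \<Rightarrow> real mat" where
  "X_L n xs = mat_of_cols (2 * n) (butlast xs)"

definition X_R :: "nat \<Rightarrow> real vec list \<Rightarrow> real mat" where
  "X_R n xs = mat_of_cols (2 * n) (tl xs)"

definition H_hat :: "nat \<Rightarrow> real vec list \<Rightarrow> real mat" where
  "H_hat n xs =
     (let M = X_R n xs * pseudoinverse (X_L n xs) in M + (J_mat n)\<^sup>T * M\<^sup>T * J_mat n)"

end

theory Submission
  imports Defs "Jordan_Normal_Form.DL_Rank"
begin

text \<open>
  Let \<open>P = X\<^sub>L X\<^sub>L\<^sup>+\<close> be the orthogonal projection onto the span of \<open>x\<^sub>1, \<dots>, x\<^sub>n\<^sub>-\<^sub>1\<close> and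
  \<open>Q = J\<^sup>T P J\<close>, again an orthogonal projection. For \<open>H \<in> HK(B)\<close> one has \<open>X\<^sub>R X\<^sub>L\<^sup>+ = H P\<close>, and
  skew-Hamiltonicity turns \<open>J\<^sup>T (H P)\<^sup>T J\<close> into \<open>Q H\<close>, so \<open>H P + Q H\<close> is the matrix of the theorem.
  Isotropy gives \<open>Q H P = 0\<close>. Hence \<open>K = H - H P - Q H\<close> satisfies \<open>K P = 0 = Q K\<close>, which makes it
  orthogonal to \<open>H P + Q H\<close> in the Frobenius inner product, and Pythagoras finishes the proof.
\<close>

section \<open>The Frobenius inner product and orthogonality\<close>

definition frobenius_inner :: "real mat \<Rightarrow> real mat \<Rightarrow> real" where
  "frobenius_inner A B = (\<Sum>i<dim_row A. \<Sum>j<dim_col A. A $$ (i, j) * B $$ (i, j))"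

lemma frobenius_norm_eq_sqrt_inner: "frobenius_norm A = sqrt (frobenius_inner A A)"
  by (simp add: frobenius_norm_def frobenius_inner_def power2_eq_square)

lemma frobenius_inner_self_nonneg: "0 \<le> frobenius_inner A A"
  by (simp add: frobenius_inner_def sum_nonneg)

lemma frobenius_inner_commute:
  assumes "A \<in> carrier_mat m n" "B \<in> carrier_mat m n"
  shows "frobenius_inner A B = frobenius_inner B A"
  using assms by (simp add: frobenius_inner_def mult.commute)

lemma frobenius_inner_add_left:
  assumes "A \<in> carrier_mat m n" "B \<in> carrier_mat m n"
  shows "frobenius_inner (A + B) C = frobenius_inner A C + frobenius_inner B C"
  using assms by (simp add: frobenius_inner_def distrib_right sum.distrib)

lemma frobenius_inner_zero_right:
  assumes "A \<in> carrier_mat m n"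
  shows "frobenius_inner A (0\<^sub>m m n) = 0"
  using assms by (simp add: frobenius_inner_def)

text \<open>Both sides are the triple sum of A_il P_lj B_ij with the two inner sums exchanged. For
  symmetric \<open>P\<close> this says that right multiplication by \<open>P\<close> is
  self-adjoint.\<close>

lemma frobenius_inner_mult_right:
  assumes A: "A \<in> carrier_mat m k" and P: "P \<in> carrier_mat k n" and B: "B \<in> carrier_mat m n"
  shows "frobenius_inner (A * P) B = frobenius_inner A (B * P\<^sup>T)"
proof -
  have "frobenius_inner (A * P) B = (\<Sum>i<m. \<Sum>j<n. \<Sum>l<k. A $$ (i, l) * P $$ (l, j) * B $$ (i, j))"
    using assms
    by (auto simp: frobenius_inner_def scalar_prod_def sum_distrib_right atLeast0LessThan
        intro!: sum.cong)
  also have "\<dots> = (\<Sum>i<m. \<Sum>l<k. \<Sum>j<n. A $$ (i, l) * P $$ (l, j) * B $$ (i, j))"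
    by (intro sum.cong refl sum.swap)
  also have "\<dots> = frobenius_inner A (B * P\<^sup>T)"
    using assms
    by (auto simp: frobenius_inner_def scalar_prod_def sum_distrib_left atLeast0LessThan mult_ac
        intro!: sum.cong)
  finally show ?thesis .
qed

lemma frobenius_inner_transpose:
  assumes "A \<in> carrier_mat m n" "B \<in> carrier_mat m n"
  shows "frobenius_inner A\<^sup>T B\<^sup>T = frobenius_inner A B"
proof -
  have "frobenius_inner A\<^sup>T B\<^sup>T = (\<Sum>j<n. \<Sum>i<m. A $$ (i, j) * B $$ (i, j))"
    using assms by (simp add: frobenius_inner_def)
  also have "\<dots> = frobenius_inner A B"
    using assms by (subst sum.swap) (simp add: frobenius_inner_def)
  finally show ?thesis .
qed

text \<open>Transposition is an isometry for the inner product and turns left multiplication into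
  right multiplication, so the previous adjoint rule applies.\<close>

lemma frobenius_inner_mult_left:
  assumes Q: "Q \<in> carrier_mat m k" and A: "A \<in> carrier_mat k n" and B: "B \<in> carrier_mat m n"
  shows "frobenius_inner (Q * A) B = frobenius_inner A (Q\<^sup>T * B)"
proof -
  have "frobenius_inner (Q * A) B = frobenius_inner (Q * A)\<^sup>T B\<^sup>T"
    using assms by (intro frobenius_inner_transpose[symmetric]) auto
  also have "\<dots> = frobenius_inner (A\<^sup>T * Q\<^sup>T) B\<^sup>T"
    using transpose_mult[OF Q A] by simp
  also have "\<dots> = frobenius_inner A\<^sup>T (B\<^sup>T * Q\<^sup>T\<^sup>T)"
    using assms by (intro frobenius_inner_mult_right) auto
  also have "B\<^sup>T * Q\<^sup>T\<^sup>T = (Q\<^sup>T * B)\<^sup>T"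
    using Q B by (subst transpose_mult[of "Q\<^sup>T" k m B n]) auto
  also have "frobenius_inner A\<^sup>T (Q\<^sup>T * B)\<^sup>T = frobenius_inner A (Q\<^sup>T * B)"
    using assms by (intro frobenius_inner_transpose) auto
  finally show ?thesis .
qed

lemma frobenius_norm_le_add_orthogonal:
  assumes A: "A \<in> carrier_mat m n" and B: "B \<in> carrier_mat m n"
    and orth: "frobenius_inner A B = 0"
  shows "frobenius_norm A \<le> frobenius_norm (A + B)"
proof -
  have AB: "A + B \<in> carrier_mat m n" using A B by simp
  have "frobenius_inner (A + B) (A + B)
      = frobenius_inner (A + B) A + frobenius_inner (A + B) B"
    using frobenius_inner_add_left[OF A B, of "A + B"] frobenius_inner_commute[OF A AB]
      frobenius_inner_commute[OF B AB] by simp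
  also have "\<dots> = frobenius_inner A A + frobenius_inner B B"
    using orth frobenius_inner_commute[OF A B] by (simp add: frobenius_inner_add_left[OF A B])
  finally show ?thesis
    using frobenius_inner_self_nonneg[of B] by (simp add: frobenius_norm_eq_sqrt_inner)
qed

lemma add_minus_cancel_mat:
  fixes A B :: "'a::ab_group_add mat"
  assumes "A \<in> carrier_mat m n" "B \<in> carrier_mat m n"
  shows "A + (B - A) = B"
  using assms by (intro eq_matI) auto

text \<open>The map M -> M P + Q M - Q M P is an orthogonal projection on matrix space. The
  hypothesis \<open>QHP\<close> removes its last term at \<open>H\<close>, so the residual
  \<open>K\<close> below equals (1 - Q) H (1 - P).\<close>

lemma frobenius_norm_projections_le:
  assumes H: "H \<in> carrier_mat N N" and P: "P \<in> carrier_mat N N" and Q: "Q \<in> carrier_mat N N"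
    and "P\<^sup>T = P" "P * P = P" "Q\<^sup>T = Q" "Q * Q = Q" and QHP: "Q * H * P = 0\<^sub>m N N"
  shows "frobenius_norm (H * P + Q * H) \<le> frobenius_norm H"
proof -
  define K where "K = H - (H * P + Q * H)"
  have HP: "H * P \<in> carrier_mat N N" and QH: "Q * H \<in> carrier_mat N N"
    using H P Q by auto
  have S: "H * P + Q * H \<in> carrier_mat N N" by (rule add_carrier_mat[OF QH])
  have K: "K \<in> carrier_mat N N" unfolding K_def by (rule minus_carrier_mat[OF S])
  have "K * P = H * P - (H * P * P + Q * H * P)"
    unfolding K_def by (simp only: minus_mult_distrib_mat[OF H S P] add_mult_distrib_mat[OF HP QH P])
  also have "\<dots> = 0\<^sub>m N N"
    using assoc_mult_mat[OF H P P] assms HP by auto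
  finally have KP: "K * P = 0\<^sub>m N N" .
  have "Q * K = Q * H - (Q * (H * P) + Q * (Q * H))"
    unfolding K_def by (simp only: mult_minus_distrib_mat[OF Q H S] mult_add_distrib_mat[OF Q HP QH])
  also have "\<dots> = 0\<^sub>m N N"
    using assoc_mult_mat[OF Q Q H, symmetric] assoc_mult_mat[OF Q H P, symmetric] assms QH by auto
  finally have QK: "Q * K = 0\<^sub>m N N" .
  \<comment> \<open>Since \<open>P\<close> and \<open>Q\<close> are symmetric, the adjoint rules
    move them onto \<open>K\<close>, which they annihilate.\<close>
  have "frobenius_inner (H * P + Q * H) K
      = frobenius_inner H (K * P) + frobenius_inner H (Q * K)"
    using frobenius_inner_add_left[OF HP QH, of K] frobenius_inner_mult_right[OF H P K]
      frobenius_inner_mult_left[OF Q H K] assms by simp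
  also have "\<dots> = 0"
    using frobenius_inner_zero_right[OF H] by (simp add: KP QK)
  finally have "frobenius_norm (H * P + Q * H) \<le> frobenius_norm (H * P + Q * H + K)"
    by (rule frobenius_norm_le_add_orthogonal[OF S K])
  also have "H * P + Q * H + K = H"
    unfolding K_def by (rule add_minus_cancel_mat[OF S H])
  finally show ?thesis .
qed

section \<open>The matrix J\<close>

lemma J_mat_carrier: "J_mat n \<in> carrier_mat (2 * n) (2 * n)"
  by (simp add: J_mat_def mult_2)

text \<open>Orthogonality of J makes J^T P J idempotent whenever P is, and allows the
  skew-Hamiltonian equation to be rewritten as H^T J = J H.\<close>

lemma J_mat_mult_transpose: "J_mat n * (J_mat n)\<^sup>T = 1\<^sub>m (2 * n)"
proof -
  have "(J_mat n)\<^sup>T = four_block_mat (0\<^sub>m n n) (- 1\<^sub>m n) (1\<^sub>m n) (0\<^sub>m n n)"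
    unfolding J_mat_def by (subst transpose_four_block_mat[of _ n n _ n _ n]) (auto simp: transpose_uminus)
  moreover have "- 0\<^sub>m n n = (0\<^sub>m n n :: real mat)" by auto
  ultimately show ?thesis
    unfolding J_mat_def
    by (simp add: mult_four_block_mat[of _ n n _ n _ n _ _ n _ n] mult_2 flip: four_block_one_mat)
qed

section \<open>The pseudoinverse of a matrix with trivial kernel\<close>

lemma gram_matrix_det_nonzero:
  fixes A :: "real mat"
  assumes A: "A \<in> carrier_mat m n"
    and inj: "\<And>v. v \<in> carrier_vec n \<Longrightarrow> A *\<^sub>v v = 0\<^sub>v m \<Longrightarrow> v = 0\<^sub>v n"
  shows "det (A\<^sup>T * A) \<noteq> 0"
proof
  assume "det (A\<^sup>T * A) = 0"
  moreover have "A\<^sup>T * A \<in> carrier_mat n n" using A by auto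
  ultimately obtain v where v: "v \<in> carrier_vec n" "v \<noteq> 0\<^sub>v n" "(A\<^sup>T * A) *\<^sub>v v = 0\<^sub>v n"
    using det_0_iff_vec_prod_zero_field by blast
  have Av: "A *\<^sub>v v \<in> carrier_vec m" using A v by auto
  \<comment> \<open>The Gram matrix has the same kernel as \<open>A\<close>, because the squared
    length of A v is v . (A^T A v).\<close>
  have "A\<^sup>T *\<^sub>v (A *\<^sub>v v) = 0\<^sub>v n" using assoc_mult_mat_vec[of "A\<^sup>T" n m A n v] A v by auto
  then have "(A *\<^sub>v v) \<bullet> (A *\<^sub>v v) = 0"
    using transpose_vec_mult_scalar[OF A v(1) Av] v by simp
  then have "A *\<^sub>v v = 0\<^sub>v m"
    using conjugate_square_eq_0_vec[OF Av] by simp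
  then show False using inj v by blast
qed

text \<open>The witness is G A^T with G the inverse of the Gram matrix. A matrix without columns is
  covered, as its kernel condition holds trivially.\<close>

lemma is_pseudoinverse_pseudoinverse:
  assumes A: "A \<in> carrier_mat m n"
    and inj: "\<And>v. v \<in> carrier_vec n \<Longrightarrow> A *\<^sub>v v = 0\<^sub>v m \<Longrightarrow> v = 0\<^sub>v n"
  shows "is_pseudoinverse A (pseudoinverse A)"
proof -
  define S where "S = A\<^sup>T * A"
  have S: "S \<in> carrier_mat n n" and At: "A\<^sup>T \<in> carrier_mat n m" using A by (auto simp: S_def)
  have "det S \<noteq> 0" unfolding S_def using gram_matrix_det_nonzero[OF A inj] .
  from det_non_zero_imp_unit[OF S this, unfolded Units_def, of "()"]
  obtain G where G: "G \<in> carrier_mat n n" and GS: "G * S = 1\<^sub>m n" and SG: "S * G = 1\<^sub>m n"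
    by (auto simp: ring_mat_def)
  have Gt: "G\<^sup>T \<in> carrier_mat n n" using G by simp
  have St: "S\<^sup>T = S" unfolding S_def by (subst transpose_mult[OF At A]) simp
  \<comment> \<open>Transposing \<open>G * S = 1\<^sub>m n\<close> shows that the transpose of
    \<open>G\<close> is a right inverse of the symmetric \<open>S\<close>, hence equal to
    \<open>G\<close>.\<close>
  have "S * G\<^sup>T = 1\<^sub>m n"
    using transpose_mult[OF G S] GS St by simp
  then have Gsym: "G\<^sup>T = G"
    using assoc_mult_mat[OF G S Gt] GS G Gt by simp
  have GA: "G * A\<^sup>T \<in> carrier_mat n m" using G At by simp
  have PA: "G * A\<^sup>T * A = 1\<^sub>m n" using assoc_mult_mat[OF G At A] GS by (simp add: S_def)
  have AP: "(A * (G * A\<^sup>T))\<^sup>T = A * (G * A\<^sup>T)"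
    using transpose_mult[OF A GA] transpose_mult[OF G At] Gsym assoc_mult_mat[OF A G At] by simp
  have "is_pseudoinverse A (G * A\<^sup>T)"
    unfolding is_pseudoinverse_def
    using A GA PA AP assoc_mult_mat[OF A GA A] left_mult_one_mat[OF GA] by simp
  then show ?thesis using pseudoinverse_eqI by metis
qed

section \<open>The matrices of the two shifted column lists\<close>

lemma X_L_carrier: "X_L n xs \<in> carrier_mat (2 * n) (length xs - 1)"
  using mat_of_cols_carrier(1)[of "2 * n" "butlast xs"] by (simp add: X_L_def)

lemma X_R_carrier: "X_R n xs \<in> carrier_mat (2 * n) (length xs - 1)"
  using mat_of_cols_carrier(1)[of "2 * n" "tl xs"] by (simp add: X_R_def)

lemma col_X_L:
  assumes "set xs \<subseteq> carrier_vec (2 * n)" "j < length xs - 1"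
  shows "col (X_L n xs) j = xs ! j"
  using assms nth_mem[of j xs] by (simp add: X_L_def nth_butlast subset_iff)

lemma col_X_R:
  assumes "set xs \<subseteq> carrier_vec (2 * n)" "j < length xs - 1"
  shows "col (X_R n xs) j = xs ! Suc j"
  using assms nth_mem[of "Suc j" xs] by (simp add: X_R_def nth_tl subset_iff)

lemma subspace_of_carrier:
  assumes "subspace_of m L"
  shows "L \<subseteq> carrier_vec m"
  using assms by (simp add: VectorSpace.subspace_def submodule_def module_vec_simps)

text \<open>The basis property refers to the space with carrier \<open>L\<close>. Independence is
  transported to the ambient space, where the columns of \<open>X_L\<close> live.\<close>

lemma ordered_basis_lin_indpt:
  assumes "subspace_of m L" "ordered_basis m L xs"
  shows "set xs \<subseteq> L" "distinct xs" "\<not> module.lin_dep class_ring (real_space m) (set xs)"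
proof -
  interpret V: vec_space "TYPE(real)" m .
  have sub: "submodule class_ring L V.V" using assms by simp
  interpret W: vectorspace class_ring "V.V\<lparr>carrier := L\<rparr>"
    using V.subspace_is_vs assms by simp
  have b: "W.basis (set xs)" and "distinct xs"
    using assms by (auto simp: ordered_basis_def)
  show "distinct xs" by fact
  show L: "set xs \<subseteq> L" using b by (simp add: W.basis_def)
  show "V.lin_indpt (set xs)"
    using b V.span_li_not_depend(2)[OF L sub] by (simp add: W.basis_def)
qed

text \<open>A nonzero kernel vector is a linear dependence among the columns. Distinctness matters
  here: dependence is a notion for sets, and a repeated column would give a kernel vector without a
  dependence of the set.\<close>

lemma X_L_kernel_trivial:
  assumes "subspace_of (2 * n) L" "ordered_basis (2 * n) L xs"
    and v: "v \<in> carrier_vec (length xs - 1)" "X_L n xs *\<^sub>v v = 0\<^sub>v (2 * n)"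
  shows "v = 0\<^sub>v (length xs - 1)"
proof (rule ccontr)
  assume nz: "v \<noteq> 0\<^sub>v (length xs - 1)"
  interpret V: vec_space "TYPE(real)" "2 * n" .
  note xs = ordered_basis_lin_indpt[OF assms(1,2)]
  have butlast: "set (butlast xs) \<subseteq> set xs" by (auto dest: in_set_butlastD)
  then have cols: "cols (X_L n xs) = butlast xs"
    unfolding X_L_def using xs(1) subspace_of_carrier[OF assms(1)]
    by (intro cols_mat_of_cols) auto
  have "V.lin_dep (set (cols (X_L n xs)))"
    by (rule V.lin_depI[OF X_L_carrier v(1) nz v(2)]) (simp add: cols distinct_butlast xs(2))
  then show False using xs(3) V.subset_li_is_li[OF _ butlast] cols by metis
qed

text \<open>Every entry has the form x . (J y) with x and y in \<open>L\<close>, so isotropy makes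
  it vanish.\<close>

lemma X_L_J_X_R_eq_0:
  assumes "isotropic n L" "set xs \<subseteq> L"
  shows "(X_L n xs)\<^sup>T * (J_mat n * X_R n xs) = 0\<^sub>m (length xs - 1) (length xs - 1)"
proof (rule eq_matI)
  fix i j
  assume "i < dim_row (0\<^sub>m (length xs - 1) (length xs - 1))"
    and "j < dim_col (0\<^sub>m (length xs - 1) (length xs - 1))"
  then have i: "i < length xs - 1" and j: "j < length xs - 1" by auto
  have L: "L \<subseteq> carrier_vec (2 * n)"
    using assms subspace_of_carrier by (auto simp: isotropic_def)
  have "xs ! i \<in> L" "xs ! Suc j \<in> L" using i j assms(2) by (auto intro!: nth_mem)
  then have "col (X_L n xs) i \<bullet> (J_mat n *\<^sub>v col (X_R n xs) j) = 0"
    using assms i j L by (simp add: isotropic_def col_X_L col_X_R)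
  then show "((X_L n xs)\<^sup>T * (J_mat n * X_R n xs)) $$ (i, j)
      = 0\<^sub>m (length xs - 1) (length xs - 1) $$ (i, j)"
    using i j X_L_carrier[of n xs] X_R_carrier[of n xs] J_mat_carrier[of n]
    by (simp add: col_mult2[OF J_mat_carrier X_R_carrier] del: col_mult)
qed (use X_L_carrier[of n xs] X_R_carrier[of n xs] J_mat_carrier[of n] in auto)

lemma HK_mult_X_L:
  assumes "H \<in> HK n xs" "set xs \<subseteq> carrier_vec (2 * n)"
  shows "H * X_L n xs = X_R n xs"
proof -
  have H: "H \<in> carrier_mat (2 * n) (2 * n)"
    using assms by (simp add: HK_def skew_hamiltonian_def)
  show ?thesis
  proof (rule mat_col_eqI)
    fix j assume "j < dim_col (X_R n xs)"
    then have j: "j < length xs - 1" using X_R_carrier[of n xs] by simp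
    have "col (H * X_L n xs) j = H *\<^sub>v col (X_L n xs) j"
      using j by (intro col_mult2[OF H X_L_carrier])
    moreover have "H *\<^sub>v (xs ! j) = xs ! Suc j"
      using assms(1) j by (simp add: HK_def)
    ultimately show "col (H * X_L n xs) j = col (X_R n xs) j"
      using j assms(2) by (simp add: col_X_L col_X_R)
  qed (use H X_L_carrier[of n xs] X_R_carrier[of n xs] in auto)
qed

theorem theorem3:
  fixes n :: nat and L :: "real vec set" and xs :: "real vec list"
  assumes "n \<ge> 1"
    and "lagrangian n L"
    and "ordered_basis (2 * n) L xs"
  shows "\<forall>H \<in> HK n xs. frobenius_norm (H_hat n xs) \<le> frobenius_norm H"
proof
  fix H assume HK: "H \<in> HK n xs"
  define N k J A B X P Q where "N = 2 * n" and "k = length xs - 1" and "J = J_mat n"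
    and "A = X_L n xs" and "B = X_R n xs" and "X = pseudoinverse A"
    and "P = A * X" and "Q = J\<^sup>T * P * J"
  have iso: "isotropic n L" using assms(2) by (simp add: lagrangian_def)
  then have sub: "subspace_of (2 * n) L" by (simp add: isotropic_def)
  note xs = ordered_basis_lin_indpt[OF sub assms(3)]
  have H: "H \<in> carrier_mat N N" and skew: "J\<^sup>T * H\<^sup>T * J = H"
    using HK by (simp_all add: HK_def skew_hamiltonian_def N_def J_def)
  have J: "J \<in> carrier_mat N N" and JJ: "J * J\<^sup>T = 1\<^sub>m N"
    using J_mat_carrier J_mat_mult_transpose by (simp_all add: J_def N_def)
  have A: "A \<in> carrier_mat N k" and B: "B \<in> carrier_mat N k"
    using X_L_carrier X_R_carrier by (simp_all add: A_def B_def N_def k_def)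
  have "is_pseudoinverse A X"
    unfolding X_def A_def
    by (rule is_pseudoinverse_pseudoinverse[OF X_L_carrier]) (rule X_L_kernel_trivial[OF sub assms(3)])
  then have X: "X \<in> carrier_mat k N" and PA: "P * A = A" and Pt: "P\<^sup>T = P"
    using A by (auto simp: is_pseudoinverse_def P_def)
  have P: "P \<in> carrier_mat N N" using A X by (simp add: P_def)
  have PP: "P * P = P"
    using assoc_mult_mat[OF P A X] PA by (simp add: P_def)
  have HA: "H * A = B"
    unfolding A_def B_def
    using HK xs(1) subspace_of_carrier[OF sub] by (intro HK_mult_X_L) auto
  have HP: "B * X = H * P"
    using assoc_mult_mat[OF H A X] HA by (simp add: P_def)
  \<comment> \<open>By symmetry P = X^T A^T, which brings the vanishing product A^T J B into
    play.\<close>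
  have PJB: "P * (J * B) = 0\<^sub>m N k"
  proof -
    have JB: "J * B \<in> carrier_mat N k" using J B by simp
    have "P * (J * B) = (X\<^sup>T * A\<^sup>T) * (J * B)"
      using transpose_mult[OF A X] Pt by (simp add: P_def)
    also have "\<dots> = X\<^sup>T * (A\<^sup>T * (J * B))"
      using A X JB by (intro assoc_mult_mat) auto
    also have "A\<^sup>T * (J * B) = 0\<^sub>m k k"
      using X_L_J_X_R_eq_0[OF iso xs(1)] by (simp add: A_def B_def J_def k_def)
    finally show ?thesis using X by simp
  qed
  have Jt: "J\<^sup>T \<in> carrier_mat N N" and Ht: "H\<^sup>T \<in> carrier_mat N N" using J H by auto
  have Q: "Q \<in> carrier_mat N N" using J P by (simp add: Q_def)
  note assoc = assoc_mult_mat[of _ N N _ N _ N]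
  \<comment> \<open>Products are normalised to the right by \<open>assoc\<close>, so J J^T = 1 and P
    P = P are needed with a trailing factor.\<close>
  have JJ_cancel: "J * (J\<^sup>T * M) = M" if "M \<in> carrier_mat N N" for M
    using assoc_mult_mat[OF J Jt that] JJ that by simp
  have PP_cancel: "P * (P * M) = P * M" if "M \<in> carrier_mat N N" for M
    using assoc_mult_mat[OF P P that] PP by simp
  have Qt: "Q\<^sup>T = Q"
    using J P Jt Pt by (simp add: Q_def transpose_mult[of _ N N _ N] assoc)
  have QQ: "Q * Q = Q"
    using J P Jt by (simp add: Q_def assoc JJ_cancel PP_cancel)
  \<comment> \<open>Replacing H P by B X exposes the factor P J B, which is zero.\<close>
  have "Q * H * P = J\<^sup>T * (P * (J * (B * X)))"
    using J P Jt H by (simp add: Q_def HP assoc)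
  also have "J * (B * X) = (J * B) * X"
    using assoc_mult_mat[OF J B X] by simp
  also have "P * \<dots> = P * (J * B) * X"
    using J B X P by (intro assoc_mult_mat[symmetric]) auto
  finally have QHP: "Q * H * P = 0\<^sub>m N N"
    using PJB X Jt by simp
  \<comment> \<open>Multiply \<open>skew\<close> by \<open>J\<close> on the left. Then J^T (H P)^T J
    = J^T P H^T J = J^T P J H, which is Q H.\<close>
  have "H\<^sup>T * J = J * H"
    using skew JJ_cancel[of "H\<^sup>T * J"] J H Jt Ht by (simp add: assoc)
  then have QH: "J\<^sup>T * (H * P)\<^sup>T * J = Q * H"
    using J Jt H Ht P Pt by (simp add: Q_def transpose_mult[OF H P] assoc)
  have "H_hat n xs = H * P + Q * H"
    using HP QH by (simp add: H_hat_def Let_def A_def B_def X_def J_def)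
  with frobenius_norm_projections_le[OF H P Q Pt PP Qt QQ QHP]
  show "frobenius_norm (H_hat n xs) \<le> frobenius_norm H" by simp
qed

end
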